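(* For every integer $n\geq 1$, the equivariant category of the action of the special unitary group $SU(n+1)$ on itself by conjugation satisfies $$\mathrm{cat}_{SU(n+1)}\,SU(n+1)=n+1.$$
   Context: Equivariant category: for a topological group $G$ acting on a space $X$, an open $G$-invariant set $U\subset X$ is $G$-categorical if there is a homotopy $H:U\times[0,1]\to X$ with $gH(x,t)=H(gx,t)$ for all $g\in G$, $x\in U$, $t\in[0,1]$, such that $H_0$ is the inclusion and $H_1$ maps $U$ into a single $G$-orbit. $\mathrm{cat}_G(X)$ is the least number of $G$-categorical sets needed to cover $X$ ($\infty$ if there is no such finite cover). Here $G=X=SU(n+1)$ with action $g\cdot x=gxg^{-1}$. *)

theory Defs
  imports "HOL-Analysis.Analysis" "HOL-Algebra.Group_Action" "HOL-Library.Extended_Nat"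
begin

section \<open>Topological group actions and equivariant category\<close>

locale topological_group_action = group_action G "topspace X" \<phi>
  for G :: "('g, 'm) monoid_scheme" (structure)
    and T :: "'g topology" and X :: "'a topology" and \<phi> :: "'g \<Rightarrow> 'a \<Rightarrow> 'a" +
  assumes topspace_group: "topspace T = carrier G"
    and continuous_mult: "continuous_map (prod_topology T T) T (\<lambda>(g, h). g \<otimes> h)"
    and continuous_inv: "continuous_map T T (\<lambda>g. inv g)"
    and continuous_action: "continuous_map (prod_topology T X) X (\<lambda>(g, x). \<phi> g x)"

text \<open>The next two definitions are total; they have their intended meaning when
  \<open>topological_group_action G T X \<phi>\<close> holds for the topology \<open>T\<close> of \<open>G\<close>, which itself does not
  enter into them.\<close>

definition G_categorical ::
    "('g, 'm) monoid_scheme \<Rightarrow> ('g \<Rightarrow> 'a \<Rightarrow> 'a) \<Rightarrow> 'a topology \<Rightarrow> 'a set \<Rightarrow> bool" where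
  "G_categorical G \<phi> X U \<longleftrightarrow>
     openin X U \<and>
     (\<forall>g\<in>carrier G. \<forall>x\<in>U. \<phi> g x \<in> U) \<and>
     (\<exists>H. continuous_map (prod_topology (subtopology X U) (top_of_set {0..1::real})) X H \<and>
          (\<forall>g\<in>carrier G. \<forall>x\<in>U. \<forall>t\<in>{0..1}. \<phi> g (H (x, t)) = H (\<phi> g x, t)) \<and>
          (\<forall>x\<in>U. H (x, 0) = x) \<and>
          (\<exists>y\<in>topspace X. \<forall>x\<in>U. H (x, 1) \<in> orbit G \<phi> y))"

text \<open>In \<^typ>\<open>enat\<close> the infimum of the empty set is \<open>\<infinity>\<close>.\<close>

definition equivariant_cat ::
    "('g, 'm) monoid_scheme \<Rightarrow> ('g \<Rightarrow> 'a \<Rightarrow> 'a) \<Rightarrow> 'a topology \<Rightarrow> enat" where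
  "equivariant_cat G \<phi> X =
     Inf {enat (card \<U>) | \<U>. finite \<U> \<and> (\<forall>U\<in>\<U>. G_categorical G \<phi> X U) \<and> topspace X \<subseteq> \<Union>\<U>}"


section \<open>The special unitary group acting on itself by conjugation\<close>

definition conj_transpose :: "complex^'n^'m \<Rightarrow> complex^'m^'n" where
  "conj_transpose A = map_matrix cnj (transpose A)"

definition special_unitary_group :: "(complex^'n^'n) monoid" where
  "special_unitary_group =
     \<lparr>carrier = {A. conj_transpose A ** A = mat 1 \<and> A ** conj_transpose A = mat 1 \<and> det A = 1},
      mult = (**), one = mat 1\<rparr>"

definition special_unitary_topology :: "(complex^'n^'n) topology" where
  "special_unitary_topology = top_of_set (carrier special_unitary_group)"

text \<open>The restriction to the carrier is needed because \<^const>\<open>group_action\<close> requires every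
  \<open>\<phi> g\<close> to be extensional.\<close>

definition conjugation_action :: "('g, 'm) monoid_scheme \<Rightarrow> 'g \<Rightarrow> 'g \<Rightarrow> 'g" where
  "conjugation_action G g = (\<lambda>x\<in>carrier G. g \<otimes>\<^bsub>G\<^esub> x \<otimes>\<^bsub>G\<^esub> inv\<^bsub>G\<^esub> g)"

lemma conj_transpose_mult: "conj_transpose (A ** B) = conj_transpose B ** conj_transpose A"
  by (simp add: conj_transpose_def map_matrix_def transpose_def matrix_matrix_mult_def vec_eq_iff
      mult.commute)

lemma conj_transpose_conj_transpose [simp]: "conj_transpose (conj_transpose A) = A"
  by (simp add: conj_transpose_def map_matrix_def transpose_def vec_eq_iff)

lemma conj_transpose_mat_1 [simp]: "conj_transpose (mat 1) = mat 1"
  by (simp add: conj_transpose_def map_matrix_def transpose_def mat_def vec_eq_iff)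

lemma det_conj_transpose: "det (conj_transpose A) = cnj (det A)" for A :: "complex^'n^'n"
proof -
  have "det (conj_transpose A) = det (map_matrix cnj A)"
    using det_transpose[of "map_matrix cnj A"]
    by (simp add: conj_transpose_def map_matrix_def transpose_def)
  also have "\<dots> = cnj (det A)"
    by (simp add: det_def)
  finally show ?thesis .
qed

lemma group_special_unitary: "group (special_unitary_group :: (complex^'n^'n) monoid)"
proof (rule groupI)
  fix A B :: "complex^'n^'n"
  assume A: "A \<in> carrier special_unitary_group" and B: "B \<in> carrier special_unitary_group"
  have "(conj_transpose B ** conj_transpose A) ** (A ** B)
      = conj_transpose B ** (conj_transpose A ** A) ** B"
    by (simp only: matrix_mul_assoc)
  moreover have "(A ** B) ** (conj_transpose B ** conj_transpose A)
      = A ** (B ** conj_transpose B) ** conj_transpose A"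
    by (simp only: matrix_mul_assoc)
  ultimately show "A \<otimes>\<^bsub>special_unitary_group\<^esub> B \<in> carrier special_unitary_group"
    using A B by (simp add: special_unitary_group_def conj_transpose_mult det_mul)
next
  fix A :: "complex^'n^'n"
  assume "A \<in> carrier special_unitary_group"
  then show "\<exists>B\<in>carrier special_unitary_group. B \<otimes>\<^bsub>special_unitary_group\<^esub> A = \<one>\<^bsub>special_unitary_group\<^esub>"
    by (intro bexI[of _ "conj_transpose A"])
       (simp_all add: special_unitary_group_def det_conj_transpose)
qed (simp_all add: special_unitary_group_def matrix_mul_assoc)

lemma inv_special_unitary:
  assumes "A \<in> carrier special_unitary_group"
  shows "inv\<^bsub>special_unitary_group\<^esub> A = conj_transpose A"
proof -
  interpret group "special_unitary_group :: (complex^'a^'a) monoid"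
    by (rule group_special_unitary)
  show ?thesis
    using assms
    by (intro inv_equality) (simp_all add: special_unitary_group_def det_conj_transpose)
qed

lemma continuous_on_conj_transpose:
  "continuous_on S f \<Longrightarrow> continuous_on S (\<lambda>x. conj_transpose (f x))"
  unfolding conj_transpose_def map_matrix_def transpose_def
  by (simp add: continuous_on_vec_lambda continuous_on_cnj continuous_on_component)

lemma continuous_on_matrix_mult:
  fixes f g :: "'a::topological_space \<Rightarrow> complex^'n^'n"
  shows "continuous_on S f \<Longrightarrow> continuous_on S g \<Longrightarrow> continuous_on S (\<lambda>x. f x ** g x)"
  unfolding matrix_matrix_mult_def
  by (intro continuous_on_vec_lambda continuous_intros) auto

theorem topological_group_action_special_unitary:
  "topological_group_action (special_unitary_group :: (complex^'n^'n) monoid)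
     special_unitary_topology special_unitary_topology
     (conjugation_action special_unitary_group)"
proof -
  let ?G = "special_unitary_group :: (complex^'n^'n) monoid"
  let ?C = "carrier ?G"
  interpret group ?G by (rule group_special_unitary)
  have mult: "A \<otimes>\<^bsub>?G\<^esub> B = A ** B" for A B
    by (simp add: special_unitary_group_def)
  have top: "topspace special_unitary_topology = ?C"
    by (simp add: special_unitary_topology_def)
  have conj: "conjugation_action ?G g x = g ** x ** conj_transpose g" if "g \<in> ?C" "x \<in> ?C" for g x
    using that by (simp add: conjugation_action_def mult inv_special_unitary)
  have prod: "prod_topology special_unitary_topology special_unitary_topology = top_of_set (?C \<times> ?C)"
    by (simp add: special_unitary_topology_def)
  have action: "group_action ?G ?C (conjugation_action ?G)"
    using action_by_conjugation by (simp add: conjugation_action_def [abs_def])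
  show ?thesis
  proof (intro topological_group_action.intro topological_group_action_axioms.intro)
    show "group_action ?G (topspace special_unitary_topology) (conjugation_action ?G)"
      using action by (simp add: top)
    show "continuous_map (prod_topology special_unitary_topology special_unitary_topology)
            special_unitary_topology (\<lambda>(g, h). g \<otimes>\<^bsub>?G\<^esub> h)"
      unfolding prod unfolding special_unitary_topology_def continuous_map_subtopology_eu
    proof
      show "continuous_on (?C \<times> ?C) (\<lambda>(g, h). g \<otimes>\<^bsub>?G\<^esub> h)"
        by (auto simp: mult case_prod_unfold intro!: continuous_on_matrix_mult continuous_intros)
    qed auto
    show "continuous_map special_unitary_topology special_unitary_topology (\<lambda>g. inv\<^bsub>?G\<^esub> g)"
      unfolding special_unitary_topology_def continuous_map_subtopology_eu
    proof
      have "continuous_on ?C conj_transpose"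
        by (rule continuous_on_conj_transpose) (rule continuous_on_id)
      then show "continuous_on ?C (\<lambda>g. inv\<^bsub>?G\<^esub> g)"
        by (rule continuous_on_eq) (simp add: inv_special_unitary)
    qed auto
    show "continuous_map (prod_topology special_unitary_topology special_unitary_topology)
            special_unitary_topology (\<lambda>(g, x). conjugation_action ?G g x)"
      unfolding prod unfolding special_unitary_topology_def continuous_map_subtopology_eu
    proof
      have "continuous_on (?C \<times> ?C) (\<lambda>p. fst p ** snd p ** conj_transpose (fst p))"
        by (intro continuous_on_matrix_mult continuous_on_conj_transpose continuous_intros)
      then show "continuous_on (?C \<times> ?C) (\<lambda>(g, x). conjugation_action ?G g x)"
        by (rule continuous_on_eq) (auto simp: conj)
      show "(\<lambda>(g, x). conjugation_action ?G g x) \<in> ?C \<times> ?C \<rightarrow> ?C"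
        using group_action.element_image [OF action] by auto
    qed
  qed (simp add: top)
qed

end

(*
  Lower bound: a central element c I is fixed by conjugation, so an equivariant homotopy moves it
  only through fixed points.  These are the n + 1 central elements, a discrete set, so c I does not
  move at all; since its orbit is a point, a categorical set contains at most one central element.

  Upper bound: every matrix in SU(n + 1) is g diag(exp(2 pi i theta)) g* with g unitary, all theta_j
  in [0, 1), and theta_1 + ... + theta_(n+1) = m for some m in {0, ..., n}.  For fixed m, let V_m
  consist of the matrices having such a form with sum of angles m and all differences
  |theta_i - theta_j| < 1; geometrically it is the open star of a vertex of the fundamental alcove.
  On V_m the angles are determined by the matrix, so scaling them linearly towards their mean
  m / (n + 1) is well defined, and contracts V_m equivariantly to a central element.
  Continuity comes from the fact that the parametrisation by pairs (g, theta), with differences at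
  most 1, is a continuous map from a compact space onto SU(n + 1), hence a quotient map.
*)

theory Submission
  imports Defs "HOL-Computational_Algebra.Fundamental_Theorem_Algebra"
begin

section \<open>Diagonalisation of unitary matrices\<close>

text \<open>This is the vector p(A) w, evaluated by Horner's scheme so that only products of
  \<open>A\<close> with vectors occur.\<close>

definition poly_apply :: "'a::field^'n^'n \<Rightarrow> 'a^'n \<Rightarrow> 'a poly \<Rightarrow> 'a^'n" where
  "poly_apply A w p = fold_coeffs (\<lambda>a u. a *s w + A *v u) p 0"

lemma poly_apply_0 [simp]: "poly_apply A w 0 = 0"
  by (simp add: poly_apply_def)

lemma poly_apply_pCons [simp]: "poly_apply A w (pCons a p) = a *s w + A *v poly_apply A w p"
  by (cases "a = 0 \<and> p = 0") (auto simp: poly_apply_def)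

lemma poly_apply_add: "poly_apply A w (p + q) = poly_apply A w p + poly_apply A w q"
  by (induction p q rule: poly_induct2) (simp_all add: vec.add vector_sadd_rdistrib algebra_simps)

lemma poly_apply_smult: "poly_apply A w (smult c p) = c *s poly_apply A w p"
  by (induction p) (simp_all add: vec.scale vector_add_ldistrib vector_smult_assoc)

lemma poly_apply_sum: "poly_apply A w (\<Sum>i\<in>I. p i) = (\<Sum>i\<in>I. poly_apply A w (p i))"
  by (induction I rule: infinite_finite_induct) (simp_all add: poly_apply_add)

lemma poly_apply_monom: "poly_apply A w (monom c i) = c *s (((*v) A) ^^ i) w"
  by (induction i) (simp_all add: monom_0 monom_Suc vec.scale)

text \<open>Since p(A) commutes with A - a I, the factor can be moved onto the vector. This trades a
  degree of the polynomial for a change of vector.\<close>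

lemma poly_apply_linear_factor:
  "poly_apply A w ([:- a, 1:] * p) = poly_apply A (A *v w - a *s w) p"
proof -
  have "poly_apply A (A *v w - a *s w) p = A *v poly_apply A w p - a *s poly_apply A w p"
  proof (induction p)
    case (pCons b p)
    have "b *s (A *v w - a *s w) = A *v (b *s w) - a *s (b *s w)"
      by (simp add: vec.scale vector_smult_assoc vector_ssub_ldistrib mult.commute)
    then show ?case
      by (simp add: pCons.IH vec.add vec.diff vec.scale vector_add_ldistrib)
  qed simp
  moreover have "[:- a, 1:] * p = smult (- a) p + pCons 0 p"
    by simp
  ultimately show ?thesis
    by (simp only: poly_apply_add poly_apply_smult poly_apply_pCons) simp
qed

text \<open>The N + 1 vectors w, A w, ..., A^N w, with N = \<open>CARD('n)\<close>, lie in a space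
  of dimension N; the coefficients of a linear relation between them form the polynomial.\<close>

lemma exists_annihilating_poly:
  fixes A :: "'a::field^'n^'n"
  obtains p where "p \<noteq> 0" "poly_apply A w p = 0"
proof -
  let ?f = "\<lambda>i. (((*v) A) ^^ i) w"
  let ?I = "{..CARD('n)}"
  show thesis
  proof (cases "inj_on ?f ?I")
    case True
    then have "card (?f ` ?I) = CARD('n) + 1"
      by (simp add: card_image)
    moreover have "vec.dim (?f ` ?I) \<le> CARD('n)"
      by (rule dim_subset_UNIV_cart_gen)
    ultimately have "vec.dependent (?f ` ?I)"
      using vec.independent_card_le_dim[of "?f ` ?I" "?f ` ?I"] by fastforce
    then obtain u v where u: "(\<Sum>v\<in>?f ` ?I. u v *s v) = 0" and v: "v \<in> ?f ` ?I" "u v \<noteq> 0"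
      by (auto simp: vec.dependent_finite)
    then obtain k where k: "k \<in> ?I" "u (?f k) \<noteq> 0"
      by blast
    let ?p = "\<Sum>i\<in>?I. monom (u (?f i)) i"
    have "coeff ?p k \<noteq> 0"
      using k by (simp add: coeff_sum)
    then have "?p \<noteq> 0"
      by force
    moreover have "poly_apply A w ?p = 0"
      using u by (simp add: poly_apply_sum poly_apply_monom sum.reindex[OF True])
    ultimately show thesis
      by (rule that)
  next
    \<comment> \<open>\<open>vec.dependent\<close> is a property of sets and does not see a vector
      that occurs twice; a repetition A^i w = A^j w yields the polynomial x^i - x^j
      directly.\<close>
    case False
    then obtain i j where ij: "i \<noteq> j" "?f i = ?f j"
      by (auto simp: inj_on_def)
    let ?p = "monom 1 i + monom (- 1) j :: 'a poly"
    have "coeff ?p i \<noteq> 0"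
      using ij by simp
    then have "?p \<noteq> 0"
      by force
    moreover have "poly_apply A w ?p = 0"
      using ij by (simp add: poly_apply_add poly_apply_monom)
    ultimately show thesis
      by (rule that)
  qed
qed

text \<open>Induction on the degree of a polynomial p that annihilates w: for a root a of p, either
  w is an eigenvector for a, or A w - a w is a nonzero element of \<open>W\<close> annihilated by p
  / (x - a).\<close>

lemma exists_eigenvector_in_invariant_set:
  fixes A :: "'a::alg_closed_field^'n^'n"
  assumes W: "\<And>a v. v \<in> W \<Longrightarrow> A *v v - a *s v \<in> W" and w: "w \<in> W" "w \<noteq> 0"
  obtains v a where "v \<in> W" "v \<noteq> 0" "A *v v = a *s v"
proof -
  obtain p where "p \<noteq> 0" "poly_apply A w p = 0"
    by (rule exists_annihilating_poly)
  then have "\<exists>v\<in>W. v \<noteq> 0 \<and> (\<exists>a. A *v v = a *s v)"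
    using w
  proof (induction "degree p" arbitrary: p w)
    case 0
    then obtain c where "p = [:c:]"
      by (metis degree_0_id)
    with 0 show ?case
      by simp
  next
    case (Suc d)
    obtain a where "poly p a = 0"
      using Suc.hyps(2) alg_closed_imp_poly_has_root[of p] by auto
    then obtain q where q: "p = [:- a, 1:] * q"
      by (metis dvdE poly_eq_0_iff_dvd)
    with Suc.prems have "q \<noteq> 0"
      by auto
    then have "degree p = Suc (degree q)"
      by (simp add: q degree_mult_eq del: mult_pCons_left)
    then have d: "d = degree q"
      using Suc.hyps(2) by simp
    show ?case
    proof (cases "A *v w - a *s w = 0")
      case True
      then show ?thesis
        using Suc.prems by auto
    next
      case False
      then show ?thesis
        using Suc.hyps(1)[OF d \<open>q \<noteq> 0\<close>, of "A *v w - a *s w"] W Suc.prems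
        by (simp add: q poly_apply_linear_factor del: mult_pCons_left)
    qed
  qed
  then show thesis
    using that by blast
qed

section \<open>The Hermitian form, unitary and diagonal matrices\<close>

definition cinner :: "complex^'n \<Rightarrow> complex^'n \<Rightarrow> complex" where
  "cinner x y = (\<Sum>i\<in>UNIV. x $ i * cnj (y $ i))"

lemma cinner_diff_left: "cinner (x - y) z = cinner x z - cinner y z"
  by (simp add: cinner_def sum_subtractf algebra_simps)

lemma cinner_scale_left: "cinner (c *s x) z = c * cinner x z"
  by (simp add: cinner_def sum_distrib_left algebra_simps)

lemma cinner_scale_right: "cinner x (c *s z) = cnj c * cinner x z"
  by (simp add: cinner_def sum_distrib_left algebra_simps)

lemma cinner_self: "cinner x x = complex_of_real ((norm x)\<^sup>2)"
  unfolding cinner_def complex_norm_square[symmetric] norm_vec_def L2_set_def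
  by (simp only: of_real_sum real_sqrt_pow2 sum_nonneg zero_le_power2)

lemma cinner_commute: "cinner y x = cnj (cinner x y)"
  by (simp add: cinner_def mult.commute)

lemma cinner_matrix_vector_mult: "cinner (A *v x) y = cinner x (conj_transpose A *v y)"
proof -
  have "cinner (A *v x) y = (\<Sum>i\<in>UNIV. \<Sum>j\<in>UNIV. A $ i $ j * x $ j * cnj (y $ i))"
    by (simp add: cinner_def matrix_vector_mult_def sum_distrib_right)
  also have "\<dots> = (\<Sum>j\<in>UNIV. \<Sum>i\<in>UNIV. A $ i $ j * x $ j * cnj (y $ i))"
    by (rule sum.swap)
  also have "\<dots> = cinner x (conj_transpose A *v y)"
    by (simp add: cinner_def matrix_vector_mult_def sum_distrib_left conj_transpose_def
        map_matrix_def transpose_def mult_ac)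
  finally show ?thesis .
qed

text \<open>One identity is enough for square matrices, where a left inverse is also a right
  inverse; \<open>unitaryD\<close> provides both.\<close>

definition unitary :: "(complex^'n^'n) set" where
  "unitary = {g. conj_transpose g ** g = mat 1}"

lemma unitaryD:
  assumes "g \<in> unitary"
  shows "conj_transpose g ** g = mat 1" "g ** conj_transpose g = mat 1"
  using assms by (auto simp: unitary_def matrix_left_right_inverse)

lemma unitary_mult: "g \<in> unitary \<Longrightarrow> h \<in> unitary \<Longrightarrow> g ** h \<in> unitary"
  by (simp add: unitary_def conj_transpose_mult)
    (metis matrix_mul_assoc matrix_mul_lid)

lemma unitary_conj_transpose: "g \<in> unitary \<Longrightarrow> conj_transpose g \<in> unitary"
  using unitaryD by (auto simp: unitary_def)

lemma special_unitary_iff: "A \<in> carrier special_unitary_group \<longleftrightarrow> A \<in> unitary \<and> det A = 1"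
  by (auto simp: special_unitary_group_def unitary_def matrix_left_right_inverse)

lemma unitary_det_mult: "g \<in> unitary \<Longrightarrow> det g * cnj (det g) = 1"
  using unitaryD(2)[of g] by (metis det_I det_conj_transpose det_mul)

definition diagonal :: "('n \<Rightarrow> 'a::zero) \<Rightarrow> 'a^'n^'n" where
  "diagonal d = (\<chi> i j. if i = j then d i else 0)"

lemma diagonal_nth [simp]: "diagonal d $ i $ j = (if i = j then d i else 0)"
  by (simp add: diagonal_def)

lemma diagonal_mult_nth [simp]: "(diagonal d ** A) $ i $ j = d i * (A $ i $ j :: 'a::semiring_1)"
  by (simp add: matrix_matrix_mult_def if_distrib if_distribR cong: if_cong)

lemma mult_diagonal_nth [simp]: "(A ** diagonal d) $ i $ j = (A $ i $ j :: 'a::semiring_1) * d j"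
  by (simp add: matrix_matrix_mult_def if_distrib if_distribR cong: if_cong)

lemma conj_transpose_nth [simp]: "conj_transpose A $ i $ j = cnj (A $ j $ i)"
  by (simp add: conj_transpose_def map_matrix_def transpose_def)

lemma conj_transpose_diagonal: "conj_transpose (diagonal d) = diagonal (\<lambda>i. cnj (d i))"
  by (simp add: vec_eq_iff)

lemma det_diagonal_prod: "det (diagonal d) = prod d (UNIV :: 'n::finite set)"
  by (subst det_diagonal) auto

lemma diagonal_const_commute: "diagonal (\<lambda>_. c) ** A = A ** diagonal (\<lambda>_. c :: 'a::comm_semiring_1)"
  by (simp add: vec_eq_iff mult.commute)

lemma diagonal_unitary_iff: "diagonal d \<in> unitary \<longleftrightarrow> (\<forall>i. cmod (d i) = 1)"
proof -
  have "cnj z * z = 1 \<longleftrightarrow> cmod z = 1" for z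
  proof -
    have "cnj z * z = complex_of_real ((cmod z)\<^sup>2)"
      by (simp only: complex_norm_square mult.commute)
    then have "cnj z * z = 1 \<longleftrightarrow> (cmod z)\<^sup>2 = 1"
      by (metis of_real_1 of_real_eq_iff)
    then show ?thesis
      by (simp add: abs_square_eq_1)
  qed
  then show ?thesis
    by (auto simp: unitary_def conj_transpose_diagonal vec_eq_iff mat_def)
qed

section \<open>Orthonormal eigenbases\<close>

text \<open>The conjugates of the given vectors are used as rows of a square matrix whose other rows
  vanish. Some row does vanish, so the matrix is singular, and a kernel vector is orthogonal to all
  of them.\<close>

lemma exists_orthogonal_vector:
  fixes v :: "'n \<Rightarrow> complex^'n::finite"
  assumes "S \<noteq> UNIV"
  obtains w where "w \<noteq> 0" "\<And>i. i \<in> S \<Longrightarrow> cinner w (v i) = 0"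
proof -
  obtain x where "x \<notin> S"
    using assms by blast
  define M :: "complex^'n^'n" where "M = (\<chi> i j. if i \<in> S then cnj (v i $ j) else 0)"
  have "row x M = 0"
    using \<open>x \<notin> S\<close> by (simp add: row_def M_def vec_eq_iff)
  then have "det M = 0"
    by (rule det_zero_row)
  then obtain w where w: "w \<noteq> 0" "M *v w = 0"
    by (metis invertible_det_nz invertible_left_inverse matrix_left_invertible_ker)
  have "cinner w (v i) = (M *v w) $ i" if "i \<in> S" for i
    using that by (simp add: cinner_def M_def matrix_vector_mult_def mult.commute)
  with w show thesis
    by (intro that) auto
qed

text \<open>Induction on the index set: the orthogonal complement \<open>W\<close> of the
  eigenvectors found so far is invariant under \<open>A\<close>, hence contains a further
  eigenvector, which is then normalised.\<close>

lemma exists_orthonormal_eigenvectors: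
  fixes A :: "complex^'n^'n" and S :: "'n set"
  assumes A: "A \<in> unitary"
  shows "\<exists>v d. \<forall>i\<in>S. A *v v i = d i *s v i \<and> (\<forall>j\<in>S. cinner (v i) (v j) = (if i = j then 1 else 0))"
  using finite[of S]
proof (induction S rule: finite_induct)
  case empty
  show ?case by simp
next
  case (insert x S)
  then obtain v d where eig: "\<And>i. i \<in> S \<Longrightarrow> A *v v i = d i *s v i"
    and orth: "\<And>i j. i \<in> S \<Longrightarrow> j \<in> S \<Longrightarrow> cinner (v i) (v j) = (if i = j then 1 else 0)"
    by blast
  define W where "W = {w. \<forall>i\<in>S. cinner w (v i) = 0}"
  have inv: "A *v w - a *s w \<in> W" if "w \<in> W" for a w
  proof -
    have "cinner (A *v w) (v i) = 0" if "i \<in> S" for i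
    proof -
      \<comment> \<open>By unitarity \<open>v i\<close> is an eigenvector of the adjoint too, with d
        i \<noteq> 0; therefore orthogonality to \<open>v i\<close> passes from w to A w.\<close>
      have "v i = (conj_transpose A ** A) *v v i"
        using unitaryD(1)[OF A] by simp
      also have "\<dots> = d i *s (conj_transpose A *v v i)"
        by (simp add: eig[OF that] vec.scale flip: matrix_vector_mul_assoc)
      finally have v: "v i = d i *s (conj_transpose A *v v i)" .
      then have "cinner w (v i) = cnj (d i) * cinner (A *v w) (v i)"
        by (metis cinner_scale_right cinner_matrix_vector_mult)
      moreover have "d i \<noteq> 0"
        using v orth[OF that that] by (auto simp: cinner_def)
      ultimately show ?thesis
        using \<open>w \<in> W\<close> that by (auto simp: W_def)
    qed
    with that show ?thesis
      by (auto simp: W_def cinner_diff_left cinner_scale_left)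
  qed
  have "S \<noteq> UNIV"
    using insert.hyps(2) by auto
  then obtain w where "w \<noteq> 0" "\<And>i. i \<in> S \<Longrightarrow> cinner w (v i) = 0"
    using exists_orthogonal_vector[of S v] by metis
  then have w: "w \<in> W" "w \<noteq> 0"
    by (simp_all add: W_def)
  obtain u a where u: "u \<in> W" "u \<noteq> 0" "A *v u = a *s u"
    by (rule exists_eigenvector_in_invariant_set[OF inv w])
  define c where "c = complex_of_real (inverse (norm u))"
  define u' where "u' = c *s u"
  have "A *v u' = a *s u'"
  proof -
    have "A *v u' = c *s (A *v u)"
      unfolding u'_def by (rule vec.scale)
    also have "\<dots> = a *s u'"
      unfolding u'_def u(3) by (simp add: vector_smult_assoc mult.commute)
    finally show ?thesis .
  qed
  moreover have "cinner u' u' = 1"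
  proof -
    have "cinner u' u' = c * (cnj c * cinner u u)"
      by (simp add: u'_def cinner_scale_left cinner_scale_right)
    also have "\<dots> = of_real (inverse (norm u) * (inverse (norm u) * (norm u * norm u)))"
      by (simp only: cinner_self c_def power2_eq_square complex_cnj_complex_of_real of_real_mult)
    also have "inverse (norm u) * (inverse (norm u) * (norm u * norm u)) = 1"
      using u(2) by (simp add: field_simps)
    finally show ?thesis
      by simp
  qed
  moreover have "\<And>i. i \<in> S \<Longrightarrow> cinner u' (v i) = 0"
    using u(1) by (simp add: u'_def cinner_scale_left W_def)
  ultimately have u': "A *v u' = a *s u'" "cinner u' u' = 1" "\<And>i. i \<in> S \<Longrightarrow> cinner u' (v i) = 0"
    by simp_all
  have "cinner (v i) u' = 0" if "i \<in> S" for i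
    using u'(3)[OF that] cinner_commute[of "v i" u'] by simp
  with this u' eig orth insert.hyps(2) show ?case
    by (intro exI[of _ "v(x := u')"] exI[of _ "d(x := a)"]) simp
qed

theorem unitary_diagonalisation:
  fixes A :: "complex^'n^'n"
  assumes A: "A \<in> unitary"
  obtains g d where "g \<in> unitary" "\<And>i. cmod (d i) = 1" "A = g ** diagonal d ** conj_transpose g"
proof -
  obtain v :: "'n \<Rightarrow> complex^'n" and d
    where eig: "\<And>i. A *v v i = d i *s v i"
      and orth: "\<And>i j. cinner (v i) (v j) = (if i = j then 1 else 0)"
    using exists_orthonormal_eigenvectors[OF A, of UNIV] by auto
  define g where "g = (\<chi> i j. v j $ i)"
  have "(conj_transpose g ** g) $ i $ j = cinner (v j) (v i)" for i j
    by (simp add: matrix_matrix_mult_def g_def cinner_def mult.commute)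
  then have g: "g \<in> unitary"
    by (simp add: unitary_def vec_eq_iff orth mat_def)
  have "(A ** g) $ i $ j = (A *v v j) $ i" for i j
    by (simp add: matrix_matrix_mult_def matrix_vector_mult_def g_def)
  then have Ag: "A ** g = g ** diagonal d"
    by (simp add: vec_eq_iff eig) (simp add: g_def)
  have "A = A ** (g ** conj_transpose g)"
    by (simp add: unitaryD[OF g])
  also have "\<dots> = (A ** g) ** conj_transpose g"
    by (rule matrix_mul_assoc)
  finally have eq: "A = g ** diagonal d ** conj_transpose g"
    unfolding Ag .
  \<comment> \<open>\<open>diagonal d\<close> is a product of unitary matrices, and this forces its
    entries to have modulus 1.\<close>
  have "conj_transpose g ** (g ** diagonal d) = diagonal d"
    by (simp add: matrix_mul_assoc unitaryD[OF g])
  then have "conj_transpose g ** (A ** g) = diagonal d"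
    by (simp only: Ag)
  moreover have "conj_transpose g ** (A ** g) \<in> unitary"
    by (intro unitary_mult unitary_conj_transpose A g)
  ultimately have "diagonal d \<in> unitary"
    by simp
  then show thesis
    by (intro that[OF g _ eq]) (simp add: diagonal_unitary_iff)
qed

section \<open>Conjugacy classes and alcoves\<close>

text \<open>Angles are measured in full turns, so two of them give the same eigenvalue exactly when
  they differ by an integer.\<close>

definition phase :: "real^'n \<Rightarrow> complex^'n^'n" where
  "phase \<theta> = diagonal (\<lambda>i. cis (2 * pi * \<theta> $ i))"

definition spectral :: "(complex^'n^'n) \<times> (real^'n) \<Rightarrow> complex^'n^'n" where
  "spectral p = fst p ** phase (snd p) ** conj_transpose (fst p)"

text \<open>In the arrangement of hyperplanes on which some \<theta>_i - \<theta>_j is an integer,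
  this is the closed star of the vertex with all coordinates m / N, where N =
  \<open>CARD('n)\<close>; \<open>angles_lt\<close> is the open star. Both are invariant under
  permutations of the angles.\<close>

definition angles_le :: "int \<Rightarrow> (real^'n) set" where
  "angles_le m = {\<theta>. (\<Sum>i\<in>UNIV. \<theta> $ i) = of_int m \<and> (\<forall>i j. \<theta> $ i - \<theta> $ j \<le> 1)}"

definition angles_lt :: "int \<Rightarrow> (real^'n) set" where
  "angles_lt m = {\<theta>. (\<Sum>i\<in>UNIV. \<theta> $ i) = of_int m \<and> (\<forall>i j. \<theta> $ i - \<theta> $ j < 1)}"

lemma angles_lt_subset_le: "angles_lt m \<subseteq> angles_le m"
  by (auto simp: angles_lt_def angles_le_def less_imp_le)

lemma cis_2pi_eq_iff: "cis (2 * pi * x) = cis (2 * pi * y) \<longleftrightarrow> x - y \<in> \<int>"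
proof
  assume "cis (2 * pi * x) = cis (2 * pi * y)"
  then have "cis (2 * pi * x - 2 * pi * y) = 1"
    by (simp flip: cis_divide)
  then have "cos (2 * pi * x - 2 * pi * y) = 1"
    by (metis Re_complex_of_real cis.simps(1) of_real_1)
  then obtain n :: int where "2 * pi * x - 2 * pi * y = of_int n * 2 * pi"
    using cos_one_2pi_int by blast
  then have "2 * pi * (x - y) = 2 * pi * of_int n"
    by (simp add: algebra_simps)
  then show "x - y \<in> \<int>"
    by simp
next
  assume "x - y \<in> \<int>"
  then have "cis (2 * pi * (x - y)) = 1"
    by (rule cis_multiple_2pi)
  moreover have "cis (2 * pi * x) = cis (2 * pi * y) * cis (2 * pi * (x - y))"
    by (simp add: cis_mult algebra_simps)
  ultimately show "cis (2 * pi * x) = cis (2 * pi * y)"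
    by simp
qed

lemma phase_unitary: "phase \<theta> \<in> unitary"
  by (simp add: phase_def diagonal_unitary_iff)

lemma prod_cis: "(\<Prod>i\<in>I. cis (f i)) = cis (\<Sum>i\<in>I. f i)"
  by (induction I rule: infinite_finite_induct) (simp_all add: cis_mult)

lemma det_phase: "det (phase \<theta>) = cis (2 * pi * (\<Sum>i\<in>UNIV. \<theta> $ i))"
  by (simp add: phase_def det_diagonal_prod prod_cis sum_distrib_left)

lemma det_spectral:
  assumes "g \<in> unitary"
  shows "det (spectral (g, \<theta>)) = cis (2 * pi * (\<Sum>i\<in>UNIV. \<theta> $ i))"
  using unitary_det_mult[OF assms]
  by (simp add: spectral_def det_mul det_conj_transpose det_phase mult_ac)

lemma spectral_unitary: "g \<in> unitary \<Longrightarrow> spectral (g, \<theta>) \<in> unitary"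
  by (simp add: spectral_def unitary_mult unitary_conj_transpose phase_unitary)

lemma spectral_special_unitary:
  assumes "g \<in> unitary" "(\<Sum>i\<in>UNIV. \<theta> $ i) = of_int m"
  shows "spectral (g, \<theta>) \<in> carrier special_unitary_group"
  using assms by (simp add: special_unitary_iff spectral_unitary det_spectral)

text \<open>Conjugation changes only the frame g, so a well-defined deformation that acts on the
  angles alone is equivariant.\<close>

lemma spectral_conjugate:
  "k ** spectral (g, \<theta>) ** conj_transpose k = spectral (k ** g, \<theta>)"
  by (simp add: spectral_def conj_transpose_mult matrix_mul_assoc)

lemma spectral_const:
  assumes "g \<in> unitary"
  shows "spectral (g, \<chi> i. c) = diagonal (\<lambda>_. cis (2 * pi * c))"
proof -
  have "spectral (g, \<chi> i. c) = g ** diagonal (\<lambda>_. cis (2 * pi * c)) ** conj_transpose g"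
    by (simp add: spectral_def phase_def)
  also have "\<dots> = diagonal (\<lambda>_. cis (2 * pi * c)) ** (g ** conj_transpose g)"
    by (simp only: diagonal_const_commute[symmetric] matrix_mul_assoc)
  finally show ?thesis
    by (simp add: unitaryD(2)[OF assms])
qed

text \<open>In terms of the change of frame h, equality becomes an entrywise condition: h_ij can be
  nonzero only where the eigenvalues belonging to \<theta>_j and \<theta>'_i agree.\<close>

lemma spectral_eq_iff:
  assumes "g \<in> unitary" "g' \<in> unitary"
  shows "spectral (g, \<theta>) = spectral (g', \<theta>') \<longleftrightarrow>
    (conj_transpose g' ** g) ** phase \<theta> = phase \<theta>' ** (conj_transpose g' ** g)"
    (is "?L \<longleftrightarrow> ?R")
proof
  assume ?L
  have "(conj_transpose g' ** g) ** phase \<theta>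
      = conj_transpose g' ** (g ** phase \<theta> ** (conj_transpose g ** g))"
    by (simp add: unitaryD(1)[OF assms(1)] matrix_mul_assoc)
  also have "\<dots> = conj_transpose g' ** spectral (g, \<theta>) ** g"
    by (simp add: spectral_def matrix_mul_assoc)
  also have "\<dots> = (conj_transpose g' ** g') ** phase \<theta>' ** (conj_transpose g' ** g)"
    by (simp add: \<open>?L\<close>) (simp add: spectral_def matrix_mul_assoc)
  finally show ?R
    by (simp add: unitaryD(1)[OF assms(2)])
next
  assume ?R
  have "spectral (g, \<theta>) = (g' ** conj_transpose g') ** g ** phase \<theta> ** conj_transpose g"
    by (simp add: unitaryD(2)[OF assms(2)] spectral_def)
  also have "\<dots> = g' ** ((conj_transpose g' ** g) ** phase \<theta>) ** conj_transpose g"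
    by (simp add: matrix_mul_assoc)
  also have "\<dots> = g' ** phase \<theta>' ** conj_transpose g' ** (g ** conj_transpose g)"
    by (simp only: \<open>?R\<close> matrix_mul_assoc)
  finally show ?L
    by (simp add: unitaryD(2)[OF assms(1)] spectral_def)
qed

section \<open>Uniqueness of the angles\<close>

text \<open>Some term of the Leibniz expansion is nonzero.\<close>

lemma det_nonzero_imp_nonzero_transversal:
  fixes A :: "'a::idom^'n^'n"
  assumes "det A \<noteq> 0"
  obtains p where "p permutes UNIV" "\<And>i. A $ i $ p i \<noteq> 0"
proof -
  obtain p where "p permutes (UNIV :: 'n set)"
      and "of_int (sign p) * (\<Prod>i\<in>UNIV. A $ i $ p i) \<noteq> 0"
    using assms unfolding det_def by (auto elim!: sum.not_neutral_contains_not_neutral)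
  then show thesis
    by (intro that[of p]) auto
qed

text \<open>A positive value forces all values to be nonnegative, a negative one forces all to be
  nonpositive; either contradicts the zero sum.\<close>

lemma integer_sum_zero_small_spread:
  fixes k :: "'n::finite \<Rightarrow> int"
  assumes sum: "(\<Sum>i\<in>UNIV. k i) = 0" and spread: "\<And>i j. k i - k j \<le> 1"
  shows "k i = 0"
proof (rule ccontr)
  assume "k i \<noteq> 0"
  then consider "k i \<ge> 1" | "k i \<le> - 1"
    by linarith
  then show False
  proof cases
    case 1
    then have "k j \<ge> 0" for j
      using spread[of i j] by linarith
    then have "(\<Sum>i\<in>UNIV. k i) > 0"
      using 1 by (intro sum_pos2[where i = i]) auto
    with sum show False by simp
  next
    case 2
    then have "k j \<le> 0" for j
      using spread[of j i] by linarith
    then have "(\<Sum>i\<in>UNIV. - k i) > 0"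
      using 2 by (intro sum_pos2[where i = i]) auto
    with sum show False by (simp add: sum_negf)
  qed
qed

text \<open>An eigenvalue of the common matrix determines its angle only modulo 1; since both angle
  vectors have the same sum, a spread below 1 removes this ambiguity.\<close>

lemma angles_determined:
  fixes \<theta> \<theta>' :: "real^'n"
  assumes g: "g \<in> unitary" "g' \<in> unitary"
    and \<theta>: "\<theta> \<in> angles_lt m" "\<theta>' \<in> angles_le m"
    and eq: "spectral (g, \<theta>) = spectral (g', \<theta>')"
  shows "\<theta>' \<in> angles_lt m"
    and "spectral (g, \<chi> i. f (\<theta> $ i)) = spectral (g', \<chi> i. f (\<theta>' $ i))"
proof -
  define h where "h = conj_transpose g' ** g"
  have h: "h ** phase \<theta> = phase \<theta>' ** h"
    using eq g by (simp add: spectral_eq_iff h_def)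
  have int: "\<theta> $ j - \<theta>' $ i \<in> \<int>" if "h $ i $ j \<noteq> 0" for i j
  proof -
    have "(h ** phase \<theta>) $ i $ j = (phase \<theta>' ** h) $ i $ j"
      by (simp only: h)
    then have "cis (2 * pi * \<theta> $ j) = cis (2 * pi * \<theta>' $ i)"
      using that by (simp add: phase_def)
    then show ?thesis
      by (simp only: cis_2pi_eq_iff)
  qed
  have "h \<in> unitary"
    unfolding h_def by (intro unitary_mult unitary_conj_transpose g)
  then have "det h \<noteq> 0"
    using unitary_det_mult[of h] by auto
  \<comment> \<open>The permutation pairs each angle of \<theta>' with an angle of \<theta> that has
    the same eigenvalue; the pairs differ by integers k i, which will turn out to vanish.\<close>
  then obtain p where p: "p permutes UNIV" "\<And>i. h $ i $ p i \<noteq> 0"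
    by (rule det_nonzero_imp_nonzero_transversal) blast
  have "\<forall>i. \<exists>k::int. \<theta> $ p i - \<theta>' $ i = of_int k"
    using int[OF p(2)] by (auto elim!: Ints_cases)
  then obtain k :: "'n \<Rightarrow> int" where k: "\<And>i. \<theta> $ p i - \<theta>' $ i = of_int (k i)"
    by metis
  \<comment> \<open>The strict bound from \<theta> and the weak one from \<theta>' add up to less
    than 2, and integrality improves this to at most 1.\<close>
  have "k i - k j \<le> 1" for i j
  proof -
    have "\<theta> $ p i - \<theta> $ p j < 1" "\<theta>' $ j - \<theta>' $ i \<le> 1"
      using \<theta> by (auto simp: angles_lt_def angles_le_def)
    with k[of i] k[of j] have "real_of_int (k i - k j) < 2"
      unfolding of_int_diff by linarith
    then show ?thesis
      by linarith
  qed
  moreover have "(\<Sum>i\<in>UNIV. k i) = 0"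
  proof -
    have "(\<Sum>i\<in>UNIV. \<theta> $ p i) = (\<Sum>i\<in>UNIV. \<theta> $ i)"
      using sum.permute[OF p(1), of "\<lambda>i. \<theta> $ i"] by (simp add: comp_def)
    then have "real_of_int (\<Sum>i\<in>UNIV. k i) = 0"
      using \<theta> by (simp add: angles_lt_def angles_le_def sum_subtractf flip: k)
    then show ?thesis
      by (simp only: of_int_eq_0_iff)
  qed
  ultimately have "k i = 0" for i
    by (rule integer_sum_zero_small_spread[rotated])
  then have perm: "\<theta>' $ i = \<theta> $ p i" for i
    using k[of i] by simp
  show "\<theta>' \<in> angles_lt m"
    using \<theta> by (simp add: angles_lt_def angles_le_def perm)
  \<comment> \<open>Beyond the pairs chosen by p, every nonzero entry of h joins equal angles, so h
    still intertwines the phases after any function f is applied to the angles.\<close>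
  have eq_angle: "\<theta> $ j = \<theta>' $ i" if "h $ i $ j \<noteq> 0" for i j
  proof -
    have "\<theta> $ j - \<theta> $ p i < 1" "\<theta> $ p i - \<theta> $ j < 1"
      using \<theta>(1) unfolding angles_lt_def by blast+
    then have "\<bar>\<theta> $ j - \<theta>' $ i\<bar> < 1"
      unfolding perm by linarith
    then have "\<theta> $ j - \<theta>' $ i = 0"
      using Ints_nonzero_abs_less1[OF int[OF that]] by blast
    then show ?thesis
      by simp
  qed
  have "h ** phase (\<chi> i. f (\<theta> $ i)) = phase (\<chi> i. f (\<theta>' $ i)) ** h"
  proof -
    have "h $ i $ j * cis (2 * pi * f (\<theta> $ j)) = cis (2 * pi * f (\<theta>' $ i)) * h $ i $ j" for i j
      by (cases "h $ i $ j = 0") (simp_all add: eq_angle)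
    then show ?thesis
      by (simp add: vec_eq_iff phase_def)
  qed
  then show "spectral (g, \<chi> i. f (\<theta> $ i)) = spectral (g', \<chi> i. f (\<theta>' $ i))"
    by (simp add: spectral_eq_iff[OF g] h_def)
qed

section \<open>Existence of angles with a prescribed sum\<close>

lemma exists_angle:
  assumes "cmod z = 1"
  obtains x where "0 \<le> x" "x < 1" "cis (2 * pi * x) = z"
proof
  let ?x = "Arg z / (2 * pi)"
  show "0 \<le> frac ?x" "frac ?x < 1"
    by (simp_all add: frac_lt_1)
  have "cis (2 * pi * frac ?x) = cis (2 * pi * ?x)"
    unfolding cis_2pi_eq_iff by (simp add: frac_def)
  also have "2 * pi * ?x = Arg z"
    by simp
  also have "cis (Arg z) = z"
    using assms by (subst cis_Arg) (auto simp: sgn_eq)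
  finally show "cis (2 * pi * frac ?x) = z" .
qed

text \<open>With all angles taken in [0, 1) their differences are below 1 and their sum lies in [0,
  N), N = \<open>CARD('n)\<close>. Determinant 1 makes the sum an integer, which leaves N possible
  values.\<close>

lemma special_unitary_eq_spectral:
  fixes A :: "complex^'n^'n"
  assumes "A \<in> carrier special_unitary_group"
  obtains g \<theta> m where "g \<in> unitary" "\<theta> \<in> angles_lt m" "A = spectral (g, \<theta>)"
    "0 \<le> m" "m < int CARD('n)"
proof -
  obtain g and d :: "'n \<Rightarrow> complex" where g: "g \<in> unitary" and d: "\<And>i. cmod (d i) = 1"
    and A: "A = g ** diagonal d ** conj_transpose g"
    using assms unitary_diagonalisation[of A] by (auto simp: special_unitary_iff)
  have "\<forall>i. \<exists>x. 0 \<le> x \<and> x < 1 \<and> cis (2 * pi * x) = d i"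
    using exists_angle[OF d] by metis
  then obtain t where t: "\<And>i. 0 \<le> t i" "\<And>i. t i < 1" "\<And>i. cis (2 * pi * t i) = d i"
    by metis
  define \<theta> :: "real^'n" where "\<theta> = (\<chi> i. t i)"
  have A: "A = spectral (g, \<theta>)"
    by (simp add: A spectral_def phase_def \<theta>_def t)
  then have "cis (2 * pi * (\<Sum>i\<in>UNIV. \<theta> $ i)) = cis (2 * pi * 0)"
    using assms det_spectral[OF g, of \<theta>] by (simp add: special_unitary_iff)
  then have "(\<Sum>i\<in>UNIV. \<theta> $ i) \<in> \<int>"
    unfolding cis_2pi_eq_iff by simp
  then obtain m where m: "(\<Sum>i\<in>UNIV. \<theta> $ i) = of_int m"
    by (elim Ints_cases)
  have "(\<Sum>i\<in>UNIV. \<theta> $ i) \<ge> 0"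
    by (simp add: \<theta>_def t sum_nonneg)
  moreover have "(\<Sum>i\<in>UNIV. \<theta> $ i) < (\<Sum>i\<in>(UNIV :: 'n set). 1)"
    by (intro sum_strict_mono) (auto simp: \<theta>_def t)
  ultimately have "0 \<le> m" "m < int CARD('n)"
    unfolding m by simp_all
  moreover have "\<theta> $ i - \<theta> $ j < 1" for i j
    using t(1)[of j] t(2)[of i] by (simp add: \<theta>_def)
  then have "\<theta> \<in> angles_lt m"
    by (simp add: angles_lt_def m)
  ultimately show thesis
    using that g A by blast
qed

text \<open>Raising a smallest angle by a full turn does not change the phase matrix. The spread
  stays at most 1, but it can become equal to 1, so this works for \<open>angles_le\<close> and not
  for \<open>angles_lt\<close>.\<close>

lemma angles_le_shift_up:
  fixes \<theta> :: "real^'n"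
  assumes "\<theta> \<in> angles_le m"
  obtains \<theta>' where "\<theta>' \<in> angles_le (m + 1)" "phase \<theta>' = phase \<theta>"
proof -
  have "Min (range (($) \<theta>)) \<in> range (($) \<theta>)"
    by (intro Min_in) auto
  then obtain k where "\<theta> $ k = Min (range (($) \<theta>))"
    by (metis rangeE)
  then have k: "\<theta> $ k \<le> \<theta> $ i" for i
    by simp
  show thesis
  proof
    have "(\<theta> + axis k 1) $ i - (\<theta> + axis k 1) $ j \<le> 1" for i j
    proof -
      have "\<theta> $ i - \<theta> $ j \<le> 1"
        using assms by (simp add: angles_le_def)
      then show ?thesis
        using k[of j] by (cases "j = k") (simp_all add: axis_def)
    qed
    moreover have "(\<Sum>i\<in>UNIV. (\<theta> + axis k 1) $ i) = of_int (m + 1)"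
      using assms by (simp add: angles_le_def sum.distrib axis_def)
    ultimately show "\<theta> + axis k 1 \<in> angles_le (m + 1)"
      by (simp only: angles_le_def mem_Collect_eq simp_thms)
    show "phase (\<theta> + axis k 1) = phase \<theta>"
      by (simp add: phase_def vec_eq_iff cis_2pi_eq_iff axis_def)
  qed
qed

text \<open>Negating the angles conjugates the phase matrix and exchanges lowering the sum with
  raising it.\<close>

lemma angles_le_shift_down:
  fixes \<theta> :: "real^'n"
  assumes "\<theta> \<in> angles_le m"
  obtains \<theta>' where "\<theta>' \<in> angles_le (m - 1)" "phase \<theta>' = phase \<theta>"
proof -
  have conj: "phase (- v) = conj_transpose (phase v)" for v :: "real^'n"
    by (simp add: phase_def conj_transpose_diagonal cis_cnj)
  have "- \<theta> \<in> angles_le (- m)"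
    using assms by (auto simp: angles_le_def sum_negf algebra_simps)
  then obtain \<theta>' where \<theta>': "\<theta>' \<in> angles_le (- m + 1)" "phase \<theta>' = phase (- \<theta>)"
    by (rule angles_le_shift_up)
  show thesis
  proof
    show "- \<theta>' \<in> angles_le (m - 1)"
      using \<theta>'(1) by (auto simp: angles_le_def sum_negf algebra_simps)
    show "phase (- \<theta>') = phase \<theta>"
      by (simp add: conj \<theta>'(2))
  qed
qed

text \<open>For each fixed m the parametrisation by closed-star angles is onto; this surjectivity
  makes it a quotient map.\<close>

lemma special_unitary_eq_spectral_le:
  fixes A :: "complex^'n^'n"
  assumes "A \<in> carrier special_unitary_group"
  obtains g \<theta> where "g \<in> unitary" "\<theta> \<in> angles_le m" "A = spectral (g, \<theta>)"
proof -
  obtain g and \<theta>\<^sub>0 :: "real^'n" and m\<^sub>0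
    where g: "g \<in> unitary" and \<theta>\<^sub>0: "\<theta>\<^sub>0 \<in> angles_lt m\<^sub>0" "A = spectral (g, \<theta>\<^sub>0)"
    using special_unitary_eq_spectral[OF assms] by metis
  have "\<exists>\<theta> \<in> angles_le m. phase \<theta> = phase \<theta>\<^sub>0"
  proof (induction m rule: int_induct[of _ m\<^sub>0])
    case base
    show ?case
      using \<theta>\<^sub>0(1) angles_lt_subset_le by blast
  next
    case (step1 i)
    then show ?case
      by (metis angles_le_shift_up)
  next
    case (step2 i)
    then show ?case
      by (metis angles_le_shift_down)
  qed
  then show thesis
    using that[OF g] \<theta>\<^sub>0(2) by (auto simp: spectral_def)
qed

section \<open>The categorical sets\<close>

text \<open>Columns of a unitary matrix are unit vectors, which bounds every entry by 1.\<close>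

lemma compact_unitary: "compact (unitary :: (complex^'n^'n) set)"
proof -
  have "norm g \<le> real CARD('n) * real CARD('n)" if "g \<in> unitary" for g :: "complex^'n^'n"
  proof -
    have entry: "cmod (g $ i $ j) \<le> 1" for i j
    proof -
      have "(\<Sum>k\<in>UNIV. cnj (g $ k $ j) * g $ k $ j) = (conj_transpose g ** g) $ j $ j"
        by (simp add: matrix_matrix_mult_def)
      also have "\<dots> = 1"
        by (simp add: unitaryD(1)[OF that] mat_def)
      also have "(\<Sum>k\<in>UNIV. cnj (g $ k $ j) * g $ k $ j) = of_real (\<Sum>k\<in>UNIV. (cmod (g $ k $ j))\<^sup>2)"
        by (simp only: mult.commute[of "cnj _"] of_real_sum complex_norm_square)
      finally have "(\<Sum>k\<in>UNIV. (cmod (g $ k $ j))\<^sup>2) = 1"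
        by (simp only: of_real_eq_1_iff)
      moreover have "(cmod (g $ i $ j))\<^sup>2 \<le> (\<Sum>k\<in>UNIV. (cmod (g $ k $ j))\<^sup>2)"
        by (rule member_le_sum) auto
      ultimately show ?thesis
        by (simp add: power2_le_imp_le abs_square_le_1)
    qed
    have "norm g \<le> (\<Sum>i\<in>UNIV. norm (g $ i))"
      unfolding norm_vec_def by (rule L2_set_le_sum) simp
    also have "\<dots> \<le> (\<Sum>i\<in>UNIV. \<Sum>j\<in>UNIV. cmod (g $ i $ j))"
      by (intro sum_mono) (simp add: norm_vec_def L2_set_le_sum)
    also have "\<dots> \<le> (\<Sum>i\<in>(UNIV :: 'n set). \<Sum>j\<in>(UNIV :: 'n set). 1)"
      by (intro sum_mono entry)
    finally show ?thesis
      by simp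
  qed
  then have "bounded (unitary :: (complex^'n^'n) set)"
    by (auto simp: bounded_iff)
  moreover have "closed (unitary :: (complex^'n^'n) set)"
    unfolding unitary_def
    by (intro closed_Collect_eq continuous_on_matrix_mult continuous_on_conj_transpose continuous_intros)
  ultimately show ?thesis
    by (simp add: compact_eq_bounded_closed)
qed

lemma compact_angles_le: "compact (angles_le m :: (real^'n) set)"
proof -
  have "norm \<theta> \<le> real CARD('n) * (real CARD('n) + \<bar>real_of_int m\<bar>)"
    if "\<theta> \<in> angles_le m" for \<theta> :: "real^'n"
  proof -
    have entry: "\<bar>\<theta> $ i\<bar> \<le> real CARD('n) + \<bar>real_of_int m\<bar>" for i
    proof -
      \<comment> \<open>Averaging over j expresses a single angle by the differences and the sum,
        both of which are bounded.\<close>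
      have "real CARD('n) * \<theta> $ i = (\<Sum>j\<in>UNIV. \<theta> $ i - \<theta> $ j) + of_int m"
        using that by (simp add: angles_le_def sum_subtractf)
      moreover have "\<bar>\<Sum>j\<in>UNIV. \<theta> $ i - \<theta> $ j\<bar> \<le> (\<Sum>j\<in>(UNIV :: 'n set). 1)"
      proof (intro order_trans[OF sum_abs] sum_mono)
        show "\<bar>\<theta> $ i - \<theta> $ j\<bar> \<le> 1" for j
        proof -
          have "\<theta> $ i - \<theta> $ j \<le> 1" "\<theta> $ j - \<theta> $ i \<le> 1"
            using that unfolding angles_le_def by blast+
          then show ?thesis
            by linarith
        qed
      qed
      ultimately have "\<bar>real CARD('n) * \<theta> $ i\<bar> \<le> real CARD('n) + \<bar>real_of_int m\<bar>"
        by simp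
      moreover have "1 * \<bar>\<theta> $ i\<bar> \<le> real CARD('n) * \<bar>\<theta> $ i\<bar>"
        by (intro mult_right_mono) (simp_all add: Suc_leI)
      ultimately show ?thesis
        by (simp add: abs_mult)
    qed
    have "norm \<theta> \<le> (\<Sum>i\<in>UNIV. \<bar>\<theta> $ i\<bar>)"
      by (rule norm_le_l1_cart)
    also have "\<dots> \<le> (\<Sum>i\<in>(UNIV :: 'n set). real CARD('n) + \<bar>real_of_int m\<bar>)"
      by (intro sum_mono entry)
    finally show ?thesis
      by simp
  qed
  then have "bounded (angles_le m :: (real^'n) set)"
    by (auto simp: bounded_iff)
  moreover have "closed (angles_le m :: (real^'n) set)"
    unfolding angles_le_def
    by (intro closed_Collect_conj closed_Collect_all closed_Collect_eq closed_Collect_le continuous_intros)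
  ultimately show ?thesis
    by (simp add: compact_eq_bounded_closed)
qed

lemma open_spread_less: "open {\<theta> :: real^'n. \<forall>i j. \<theta> $ i - \<theta> $ j < r}"
proof -
  have "{\<theta> :: real^'n. \<forall>i j. \<theta> $ i - \<theta> $ j < r} = (\<Inter>i\<in>UNIV. \<Inter>j\<in>UNIV. {\<theta>. \<theta> $ i - \<theta> $ j < r})"
    by auto
  also have "open \<dots>"
    by (intro open_INT ballI open_Collect_less continuous_intros finite)
  finally show ?thesis .
qed

lemma continuous_on_phase:
  assumes f: "continuous_on S f"
  shows "continuous_on S (\<lambda>x. phase (f x))"
proof -
  have "continuous_on S (\<lambda>x. if i = j then cis (2 * pi * f x $ i) else 0)" for i j
    using f by (cases "i = j") (auto intro!: continuous_intros)
  then show ?thesis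
    unfolding phase_def diagonal_def by (intro continuous_on_vec_lambda)
qed

lemma continuous_on_spectral:
  assumes "continuous_on S f" "continuous_on S g"
  shows "continuous_on S (\<lambda>x. spectral (f x, g x))"
  unfolding spectral_def fst_conv snd_conv
  by (intro continuous_on_matrix_mult continuous_on_conj_transpose continuous_on_phase assms)

lemma conjugation_action_special_unitary:
  assumes "g \<in> carrier special_unitary_group" "x \<in> carrier special_unitary_group"
  shows "conjugation_action special_unitary_group g x = g ** x ** conj_transpose g"
  using assms by (simp add: conjugation_action_def inv_special_unitary)
    (simp add: special_unitary_group_def)

lemma mat_1_special_unitary: "mat 1 \<in> carrier special_unitary_group"
  by (simp add: special_unitary_group_def)

section \<open>Open stars and their contraction\<close>

definition alcove_star :: "int \<Rightarrow> (complex^'n^'n) set" where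
  "alcove_star m = spectral ` (unitary \<times> angles_lt m)"

lemma alcove_star_subset: "alcove_star m \<subseteq> carrier special_unitary_group"
  by (auto simp: alcove_star_def angles_lt_def intro: spectral_special_unitary)

text \<open>By \<open>angles_determined\<close> no matrix has angles both in the open star and on
  the boundary of the closed star. Since closed-star angles always exist, the open part is the
  complement of the image of the boundary.\<close>

lemma alcove_star_eq_Diff:
  "alcove_star m = carrier special_unitary_group - spectral ` (unitary \<times> angles_le m - unitary \<times> angles_lt m)"
proof (intro equalityI subsetI)
  fix A :: "complex^'n^'n"
  assume A: "A \<in> alcove_star m"
  then obtain g \<theta> where g: "g \<in> unitary" "\<theta> \<in> angles_lt m" "A = spectral (g, \<theta>)"
    by (auto simp: alcove_star_def)
  have "A \<noteq> spectral (g', \<theta>')" if "g' \<in> unitary" "\<theta>' \<in> angles_le m" "\<theta>' \<notin> angles_lt m" for g' \<theta>'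
    using angles_determined(1)[OF g(1) that(1) g(2) that(2)] g(3) that(3) by auto
  then show "A \<in> carrier special_unitary_group - spectral ` (unitary \<times> angles_le m - unitary \<times> angles_lt m)"
    using A alcove_star_subset by fast
next
  fix A :: "complex^'n^'n"
  assume A: "A \<in> carrier special_unitary_group - spectral ` (unitary \<times> angles_le m - unitary \<times> angles_lt m)"
  then obtain g \<theta> where "g \<in> unitary" "\<theta> \<in> angles_le m" "A = spectral (g, \<theta>)"
    using special_unitary_eq_spectral_le[of A m] by auto
  with A show "A \<in> alcove_star m"
    unfolding alcove_star_def by blast
qed

lemma openin_alcove_star: "openin special_unitary_topology (alcove_star m :: (complex^'n^'n) set)"
proof -
  let ?K = "unitary \<times> angles_le m :: ((complex^'n^'n) \<times> (real^'n)) set"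
  \<comment> \<open>\<open>angles_lt m\<close> is not open in the full space of angle vectors;
    replacing it by the open spread condition writes the boundary as compact minus open.\<close>
  have "?K - unitary \<times> angles_lt m = ?K - UNIV \<times> {\<theta>. \<forall>i j. \<theta> $ i - \<theta> $ j < 1}"
    by (auto simp: angles_le_def angles_lt_def)
  moreover have "compact (?K - UNIV \<times> {\<theta>. \<forall>i j. \<theta> $ i - \<theta> $ j < 1})"
    by (intro compact_diff compact_Times compact_unitary compact_angles_le open_Times open_UNIV
        open_spread_less)
  ultimately have "compact (?K - unitary \<times> angles_lt m)"
    by simp
  moreover have "continuous_on S spectral" for S :: "((complex^'n^'n) \<times> (real^'n)) set"
    using continuous_on_spectral[of S fst snd] by (simp add: continuous_intros)
  ultimately have "closed (spectral ` (?K - unitary \<times> angles_lt m))"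
    by (intro compact_imp_closed compact_continuous_image)
  then show ?thesis
    unfolding special_unitary_topology_def alcove_star_eq_Diff Diff_eq[of "carrier _"]
    by (intro openin_open_Int open_Compl)
qed

lemma conjugate_alcove_star:
  assumes "g \<in> unitary" "A \<in> alcove_star m"
  shows "g ** A ** conj_transpose g \<in> alcove_star m"
  using assms by (auto simp: alcove_star_def spectral_conjugate intro!: unitary_mult imageI)

text \<open>The frame is kept and the angles move linearly to their mean. The map is defined on
  pairs (g, \<theta>) and then descended to matrices along a quotient map.\<close>

lemma alcove_star_contraction:
  obtains H where
    "continuous_map (top_of_set ((alcove_star m :: (complex^'n^'n) set) \<times> {0..1::real}))
       special_unitary_topology H"
    "\<And>g \<theta> t. g \<in> unitary \<Longrightarrow> \<theta> \<in> angles_lt m \<Longrightarrow> t \<in> {0..1} \<Longrightarrow>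
       H (spectral (g, \<theta>), t) = spectral (g, \<chi> i. (1 - t) * \<theta> $ i + t * (m / real CARD('n)))"
proof -
  let ?S = "carrier special_unitary_group :: (complex^'n^'n) set"
  let ?I = "{0..1::real}"
  let ?K = "(unitary \<times> angles_le m) \<times> ?I :: (((complex^'n^'n) \<times> (real^'n)) \<times> real) set"
  let ?P = "(unitary \<times> angles_lt m) \<times> ?I :: (((complex^'n^'n) \<times> (real^'n)) \<times> real) set"
  define F :: "((complex^'n^'n) \<times> (real^'n)) \<times> real \<Rightarrow> (complex^'n^'n) \<times> real"
    where "F = (\<lambda>(p, t). (spectral p, t))"
  define f where "f t x = (1 - t) * x + t * (m / real CARD('n))" for t x :: real
  define h :: "((complex^'n^'n) \<times> (real^'n)) \<times> real \<Rightarrow> complex^'n^'n"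
    where "h = (\<lambda>((g, \<theta>), t). spectral (g, \<chi> i. f t (\<theta> $ i)))"
  \<comment> \<open>A continuous surjection from a compact space onto a Hausdorff space is a
    quotient map. The time interval is a factor from the start, so no product of quotient maps has
    to be formed.\<close>
  have quot_F: "quotient_map (top_of_set ?K) (top_of_set (?S \<times> ?I)) F"
  proof (rule continuous_imp_quotient_map)
    have "continuous_on ?K (\<lambda>x. (spectral (fst (fst x), snd (fst x)), snd x))"
      by (intro continuous_on_Pair continuous_on_spectral continuous_intros)
    then have "continuous_on ?K F"
      by (simp add: F_def case_prod_unfold)
    moreover have "F \<in> ?K \<rightarrow> ?S \<times> ?I"
      by (auto simp: F_def angles_le_def intro: spectral_special_unitary)
    ultimately show "continuous_map (top_of_set ?K) (top_of_set (?S \<times> ?I)) F"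
      by simp
    show "compact_space (top_of_set ?K)"
      by (simp add: compact_space_subtopology compact_Times compact_unitary compact_angles_le)
    show "Hausdorff_space (top_of_set (?S \<times> ?I))"
      by (simp add: Hausdorff_space_subtopology)
    have "?S \<times> ?I \<subseteq> F ` ?K"
    proof clarify
      fix A t
      assume "A \<in> ?S" "t \<in> ?I"
      then obtain g \<theta> where "g \<in> unitary" "\<theta> \<in> angles_le m" "A = spectral (g, \<theta>)"
        using special_unitary_eq_spectral_le[of A m] by auto
      with \<open>t \<in> ?I\<close> show "(A, t) \<in> F ` ?K"
        by (intro image_eqI[of _ _ "((g, \<theta>), t)"]) (auto simp: F_def)
    qed
    with \<open>F \<in> ?K \<rightarrow> ?S \<times> ?I\<close> show "F ` topspace (top_of_set ?K) = topspace (top_of_set (?S \<times> ?I))"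
      unfolding topspace_euclidean_subtopology by (intro equalityI) (simp_all only: image_subset_iff_funcset)
  qed
  \<comment> \<open>The full preimage of the open star consists of open-star angles only, so the
    quotient map restricts to this open saturated part.\<close>
  have saturated: "{x \<in> topspace (top_of_set ?K). F x \<in> alcove_star m \<times> ?I} = ?P"
  proof (intro equalityI subsetI)
    fix x assume x: "x \<in> {x \<in> topspace (top_of_set ?K). F x \<in> alcove_star m \<times> ?I}"
    obtain g \<theta> t where [simp]: "x = ((g, \<theta>), t)"
      by (metis surj_pair)
    from x obtain g' \<theta>' where "g' \<in> unitary" "\<theta>' \<in> angles_lt m" "spectral (g', \<theta>') = spectral (g, \<theta>)"
      by (auto simp: F_def alcove_star_def)
    with x show "x \<in> ?P"
      using angles_determined(1)[of g' g \<theta>' m \<theta>] by auto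
  next
    fix x assume "x \<in> ?P"
    then show "x \<in> {x \<in> topspace (top_of_set ?K). F x \<in> alcove_star m \<times> ?I}"
      using angles_lt_subset_le[of m] by (auto simp: F_def alcove_star_def)
  qed
  have "openin (top_of_set (?S \<times> ?I)) (alcove_star m \<times> ?I)"
    using openin_alcove_star[of m] unfolding special_unitary_topology_def
    by (intro openin_Times) auto
  then have "quotient_map (subtopology (top_of_set ?K) ?P)
      (subtopology (top_of_set (?S \<times> ?I)) (alcove_star m \<times> ?I)) F"
    by (intro quotient_map_restriction[OF quot_F saturated] disjI1)
  moreover have "?K \<inter> ?P = ?P"
    using angles_lt_subset_le[of m] by auto
  moreover have "(?S \<times> ?I) \<inter> (alcove_star m \<times> ?I) = alcove_star m \<times> ?I"
    using alcove_star_subset[of m] by auto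
  ultimately have quot: "quotient_map (top_of_set ?P) (top_of_set (alcove_star m \<times> ?I)) F"
    by (simp only: subtopology_subtopology)
  have "continuous_on ?P (\<lambda>x. spectral (fst (fst x), \<chi> i. f (snd x) (snd (fst x) $ i)))"
    unfolding f_def by (intro continuous_on_spectral continuous_on_vec_lambda continuous_intros)
  then have "continuous_on ?P h"
    by (simp add: h_def case_prod_unfold)
  moreover have "h x \<in> ?S" if "x \<in> ?P" for x
  proof -
    obtain g \<theta> t where [simp]: "x = ((g, \<theta>), t)"
      by (metis surj_pair)
    \<comment> \<open>Moving towards the mean preserves the sum, so the determinant remains
      1.\<close>
    have "(\<Sum>i\<in>UNIV. f t (\<theta> $ i)) = of_int m"
    proof -
      have "(\<Sum>i\<in>UNIV. f t (\<theta> $ i)) = (1 - t) * (\<Sum>i\<in>UNIV. \<theta> $ i) + t * m"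
        by (simp add: f_def sum.distrib sum_distrib_left)
      also have "(\<Sum>i\<in>UNIV. \<theta> $ i) = m"
        using that by (simp add: angles_lt_def)
      finally show ?thesis
        by (simp add: algebra_simps)
    qed
    with that show ?thesis
      by (auto simp: h_def intro!: spectral_special_unitary)
  qed
  ultimately have cont: "continuous_map (top_of_set ?P) (top_of_set ?S) h"
    by auto
  have well_defined: "h x = h y" if "x \<in> ?P" "y \<in> ?P" "F x = F y" for x y
  proof -
    obtain g \<theta> t g' \<theta>' t' where [simp]: "x = ((g, \<theta>), t)" "y = ((g', \<theta>'), t')"
      by (metis surj_pair)
    show ?thesis
      using that angles_determined(2)[of g g' \<theta> m \<theta>' "f t"] angles_lt_subset_le[of m]
      by (auto simp: h_def F_def)
  qed
  have "\<exists>H. continuous_map (top_of_set (alcove_star m \<times> ?I)) (top_of_set ?S) H \<and>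
      (\<forall>x\<in>?P. H (F x) = h x)"
  proof (rule quotient_map_lift_exists[OF quot cont])
    show "h x = h y"
      if "x \<in> topspace (top_of_set ?P)" "y \<in> topspace (top_of_set ?P)" "F x = F y" for x y
      using that unfolding topspace_euclidean_subtopology by (rule well_defined)
  qed (unfold topspace_euclidean_subtopology, blast)
  then obtain H where H: "continuous_map (top_of_set (alcove_star m \<times> ?I)) (top_of_set ?S) H"
    "\<And>x. x \<in> ?P \<Longrightarrow> H (F x) = h x"
    by blast
  show thesis
  proof (rule that[of H])
    show "H (spectral (g, \<theta>), t) = spectral (g, \<chi> i. (1 - t) * \<theta> $ i + t * (m / real CARD('n)))"
      if "g \<in> unitary" "\<theta> \<in> angles_lt m" "t \<in> {0..1}" for g \<theta> t
      using H(2)[of "((g, \<theta>), t)"] that by (simp add: F_def h_def f_def)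
  qed (use H(1) in \<open>simp add: special_unitary_topology_def\<close>)
qed

lemma G_categorical_alcove_star:
  "G_categorical special_unitary_group (conjugation_action special_unitary_group)
     special_unitary_topology (alcove_star m :: (complex^'n^'n) set)"
proof -
  let ?S = "carrier special_unitary_group :: (complex^'n^'n) set"
  let ?I = "{0..1::real}"
  let ?\<phi> = "conjugation_action (special_unitary_group :: (complex^'n^'n) monoid)"
  let ?c = "m / real CARD('n)"
  obtain H where cont: "continuous_map (top_of_set ((alcove_star m :: (complex^'n^'n) set) \<times> ?I))
      special_unitary_topology H"
    and H: "\<And>g \<theta> t. g \<in> unitary \<Longrightarrow> \<theta> \<in> angles_lt m \<Longrightarrow> t \<in> {0..1} \<Longrightarrow>
      H (spectral (g, \<theta>), t) = spectral (g, \<chi> i. (1 - t) * \<theta> $ i + t * ?c)"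
    by (rule alcove_star_contraction) blast
  have act: "?\<phi> g x = g ** x ** conj_transpose g" if "g \<in> ?S" "x \<in> ?S" for g x
    using that by (rule conjugation_action_special_unitary)
  have HS: "H (x, t) \<in> ?S" if "x \<in> alcove_star m" "t \<in> ?I" for x t
    using cont that by (auto simp: special_unitary_topology_def continuous_map_def Pi_iff)
  have "?\<phi> g x \<in> alcove_star m" if "g \<in> ?S" "x \<in> alcove_star m" for g x
    using that alcove_star_subset[of m] conjugate_alcove_star[of g x m]
    by (auto simp: act special_unitary_iff)
  moreover have "continuous_map (prod_topology (subtopology special_unitary_topology (alcove_star m))
      (top_of_set ?I)) special_unitary_topology H"
  proof -
    have "?S \<inter> alcove_star m = alcove_star m"
      using alcove_star_subset by blast
    then show ?thesis
      using cont by (simp add: special_unitary_topology_def subtopology_subtopology)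
  qed
  \<comment> \<open>The action multiplies the frame and \<open>H\<close> changes the angles, so the
    two commute.\<close>
  moreover have "?\<phi> g (H (x, t)) = H (?\<phi> g x, t)"
    if gxt: "g \<in> ?S" "x \<in> alcove_star m" "t \<in> ?I" for g x t
  proof -
    obtain k \<theta> where k: "k \<in> unitary" "\<theta> \<in> angles_lt m" "x = spectral (k, \<theta>)"
      using gxt(2) by (auto simp: alcove_star_def)
    have "?\<phi> g x = spectral (g ** k, \<theta>)"
      using act[of g x] gxt alcove_star_subset[of m] by (auto simp: k(3) spectral_conjugate)
    moreover have "?\<phi> g (H (x, t)) = spectral (g ** k, \<chi> i. (1 - t) * \<theta> $ i + t * ?c)"
      using act[OF gxt(1) HS[OF gxt(2,3)]] gxt(3) by (simp add: k H spectral_conjugate)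
    moreover have "g ** k \<in> unitary"
      using gxt(1) k(1) by (simp add: special_unitary_iff unitary_mult)
    ultimately show ?thesis
      using k(2) gxt(3) by (simp add: H)
  qed
  moreover have "H (x, 0) = x" if "x \<in> alcove_star m" for x
    using that by (auto simp: alcove_star_def H)
  moreover have "\<exists>y\<in>topspace special_unitary_topology.
      \<forall>x\<in>alcove_star m. H (x, 1) \<in> orbit special_unitary_group ?\<phi> y"
  proof (intro bexI ballI)
    \<comment> \<open>When all angles are equal the matrix is scalar and the frame drops out, so
      every x ends at this one point.\<close>
    let ?y = "spectral (mat 1, \<chi> i. ?c) :: complex^'n^'n"
    have one: "(mat 1 :: complex^'n^'n) \<in> unitary"
      by (simp add: unitary_def)
    have y: "?y \<in> ?S"
      using one by (intro spectral_special_unitary[of _ _ m]) simp_all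
    then show "?y \<in> topspace special_unitary_topology"
      by (simp add: special_unitary_topology_def)
    fix x :: "complex^'n^'n"
    assume "x \<in> alcove_star m"
    then have "H (x, 1) = ?y"
      using one by (auto simp: alcove_star_def H spectral_const)
    also have "\<dots> = ?\<phi> (mat 1) ?y"
      using act[OF mat_1_special_unitary y] by simp
    finally show "H (x, 1) \<in> orbit special_unitary_group ?\<phi> ?y"
      unfolding orbit_def using mat_1_special_unitary by blast
  qed
  ultimately show ?thesis
    unfolding G_categorical_def using openin_alcove_star[of m] by blast
qed

section \<open>The centre\<close>

text \<open>The determinant condition already implies that c has modulus 1, and thereby
  unitarity.\<close>

lemma diagonal_const_special_unitary_iff:
  "(diagonal (\<lambda>_. c) :: complex^'n^'n) \<in> carrier special_unitary_group \<longleftrightarrow> c ^ CARD('n) = 1"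
proof -
  have "cmod c = 1" if "c ^ CARD('n) = 1"
  proof -
    have "cmod c ^ CARD('n) = 1"
      using that by (metis norm_one norm_power)
    then show ?thesis
      using power_eq_imp_eq_base[of "cmod c" "CARD('n)" 1] by simp
  qed
  then show ?thesis
    by (auto simp: special_unitary_iff diagonal_unitary_iff det_diagonal_prod)
qed

text \<open>Take c with c^N = 1 / det g, N = \<open>CARD('n)\<close>. This transfers commutation
  statements from special unitary to all unitary matrices, since the scalar cancels.\<close>

lemma special_unitary_scaling:
  fixes g :: "complex^'n^'n"
  assumes "g \<in> unitary"
  obtains c where "c \<noteq> 0" "diagonal (\<lambda>_. c) ** g \<in> carrier special_unitary_group"
proof -
  have det: "cmod (det g) = 1"
  proof -
    have "complex_of_real ((cmod (det g))\<^sup>2) = 1"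
      by (simp only: complex_norm_square unitary_det_mult[OF assms])
    then have "(cmod (det g))\<^sup>2 = 1"
      by (simp only: of_real_eq_1_iff)
    then show ?thesis
      by (simp add: abs_square_eq_1)
  qed
  obtain c where c: "c ^ CARD('n) = inverse (det g)"
    using nth_root_exists[of "CARD('n)" "inverse (det g)"] by auto
  then have "cmod c ^ CARD('n) = 1"
    using det by (simp add: norm_inverse flip: norm_power)
  then have "cmod c = 1"
    using power_eq_imp_eq_base[of "cmod c" "CARD('n)" 1] by simp
  moreover have "c ^ CARD('n) * det g = 1"
  proof -
    have "det g \<noteq> 0"
      using det by auto
    then show ?thesis
      by (simp add: c)
  qed
  ultimately have "diagonal (\<lambda>_. c) ** g \<in> carrier special_unitary_group"
    using assms by (simp add: special_unitary_iff det_mul det_diagonal_prod unitary_mult diagonal_unitary_iff)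
  moreover have "c \<noteq> 0"
    using \<open>cmod c = 1\<close> by auto
  ultimately show thesis
    using that by blast
qed

text \<open>The witness I - (2/N) J, with J the all-ones matrix and N = \<open>CARD('n)\<close>, is
  the reflection in the hyperplane orthogonal to (1, ..., 1). A diagonal matrix commuting with it
  has equal entries.\<close>

lemma exists_unitary_nonzero_off_diagonal:
  obtains R :: "complex^'n^'n" where "R \<in> unitary" "\<And>i j. i \<noteq> j \<Longrightarrow> R $ i $ j \<noteq> 0"
proof
  define s :: complex where "s = 2 / of_nat CARD('n)"
  define R :: "complex^'n^'n" where "R = (\<chi> i j. (if i = j then 1 else 0) - s)"
  have cnj_s: "cnj s = s"
    by (simp add: s_def)
  have s: "of_nat CARD('n) * s = 2"
    by (simp add: s_def)
  have "(conj_transpose R ** R) $ i $ j = mat 1 $ i $ j" for i j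
  proof -
    have "(conj_transpose R ** R) $ i $ j
        = (\<Sum>k\<in>UNIV. ((if k = i then 1 else 0) - s) * ((if k = j then 1 else 0) - s))"
      by (simp add: matrix_matrix_mult_def R_def cnj_s if_distrib[of cnj] cong: if_cong)
    also have "\<dots> = (\<Sum>k\<in>UNIV. (if k = i then (if i = j then 1 else 0) - s else 0)
        - (if k = j then s else 0) + s * s)"
      by (intro sum.cong) (auto simp: algebra_simps)
    also have "\<dots> = (if i = j then 1 else 0) - s - s + (of_nat CARD('n) * s) * s"
      by (simp add: sum.distrib sum_subtractf)
    also have "\<dots> = mat 1 $ i $ j"
      unfolding s by (simp add: mat_def)
    finally show ?thesis .
  qed
  then show "R \<in> unitary"
    by (simp add: unitary_def vec_eq_iff)
  show "R $ i $ j \<noteq> 0" if "i \<noteq> j" for i j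
    using that by (simp add: R_def s_def)
qed

lemma conjugation_fixed_point_imp_scalar:
  fixes x :: "complex^'n^'n"
  assumes x: "x \<in> carrier special_unitary_group"
    and fixed: "\<And>g. g \<in> carrier special_unitary_group \<Longrightarrow> g ** x ** conj_transpose g = x"
  obtains c where "c ^ CARD('n) = 1" "x = diagonal (\<lambda>_. c)"
proof -
  have commute: "g ** x = x ** g" if g: "g \<in> unitary" for g
  proof -
    obtain c where c: "c \<noteq> 0" "diagonal (\<lambda>_. c) ** g \<in> carrier special_unitary_group"
      using special_unitary_scaling[OF g] by blast
    define k where "k = diagonal (\<lambda>_. c) ** g"
    have k: "k \<in> unitary" "k ** x ** conj_transpose k = x"
      using c(2) fixed by (auto simp: k_def special_unitary_iff)
    have "k ** x = (k ** x ** conj_transpose k) ** k"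
      by (simp add: unitaryD(1)[OF k(1)] flip: matrix_mul_assoc)
    then have "k ** x = x ** k"
      by (simp only: k(2))
    then have "diagonal (\<lambda>_. c) ** (g ** x) = diagonal (\<lambda>_. c) ** (x ** g)"
      unfolding k_def by (metis diagonal_const_commute matrix_mul_assoc)
    then have "c * (g ** x) $ i $ j = c * (x ** g) $ i $ j" for i j
      by (metis diagonal_mult_nth)
    then show ?thesis
      using c(1) by (simp add: vec_eq_iff)
  qed
  obtain g d where g: "g \<in> unitary" "x = g ** diagonal d ** conj_transpose g"
    using x unitary_diagonalisation[of x] unfolding special_unitary_iff by metis
  \<comment> \<open>Since x commutes with the frame g that diagonalises it, x is itself
    diagonal.\<close>
  have "x = conj_transpose g ** (g ** x)"
    by (simp add: matrix_mul_assoc unitaryD(1)[OF g(1)])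
  also have "\<dots> = conj_transpose g ** (x ** g)"
    by (simp only: commute[OF g(1)])
  also have "\<dots> = (conj_transpose g ** g) ** diagonal d ** (conj_transpose g ** g)"
    by (simp only: g(2) matrix_mul_assoc)
  finally have xd: "x = diagonal d"
    by (simp add: unitaryD(1)[OF g(1)])
  obtain R :: "complex^'n^'n" where R: "R \<in> unitary" "\<And>i j. i \<noteq> j \<Longrightarrow> R $ i $ j \<noteq> 0"
    by (rule exists_unitary_nonzero_off_diagonal) blast
  have "d i = d j" for i j
  proof (cases "i = j")
    case False
    have "(R ** diagonal d) $ i $ j = (diagonal d ** R) $ i $ j"
      using commute[OF R(1)] by (simp only: xd)
    then show ?thesis
      using R(2)[OF False] by simp
  qed simp
  \<comment> \<open>All diagonal entries agree; \<open>undefined\<close> serves as an arbitrary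
    index.\<close>
  then have "x = diagonal (\<lambda>_. d undefined)"
    unfolding xd by (intro arg_cong[of _ _ diagonal]) blast
  then show thesis
    using x that diagonal_const_special_unitary_iff by metis
qed

text \<open>Every scalar matrix in \<open>U\<close> is shown to equal the base point y of the target
  orbit, so two of them coincide.\<close>

lemma G_categorical_central_unique:
  fixes U :: "(complex^'n^'n) set"
  assumes U: "G_categorical special_unitary_group (conjugation_action special_unitary_group)
      special_unitary_topology U"
    and c: "c ^ CARD('n) = 1" "diagonal (\<lambda>_. c) \<in> U"
    and c': "c' ^ CARD('n) = 1" "diagonal (\<lambda>_. c') \<in> U"
  shows "c = c'"
proof -
  let ?S = "carrier special_unitary_group :: (complex^'n^'n) set"
  let ?\<phi> = "conjugation_action (special_unitary_group :: (complex^'n^'n) monoid)"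
  let ?I = "{0..1::real}"
  obtain H y where
    cont: "continuous_map (prod_topology (subtopology special_unitary_topology U) (top_of_set ?I))
      special_unitary_topology H"
    and equiv: "\<And>g x t. g \<in> ?S \<Longrightarrow> x \<in> U \<Longrightarrow> t \<in> ?I \<Longrightarrow> ?\<phi> g (H (x, t)) = H (?\<phi> g x, t)"
    and H0: "\<And>x. x \<in> U \<Longrightarrow> H (x, 0) = x"
    and y: "y \<in> ?S"
    and H1: "\<And>x. x \<in> U \<Longrightarrow> H (x, 1) \<in> orbit special_unitary_group ?\<phi> y"
    using U unfolding G_categorical_def special_unitary_topology_def topspace_euclidean_subtopology
    by metis
  have US: "U \<subseteq> ?S"
    using U unfolding G_categorical_def special_unitary_topology_def by (auto dest: openin_imp_subset)
  have "diagonal (\<lambda>_. c) = y" if c: "c ^ CARD('n) = 1" "diagonal (\<lambda>_. c) \<in> U" for c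
  proof -
    let ?z = "diagonal (\<lambda>_. c) :: complex^'n^'n"
    have conj_z: "g ** ?z ** conj_transpose g = ?z" if "g \<in> ?S" for g
    proof -
      have "g ** ?z ** conj_transpose g = ?z ** (g ** conj_transpose g)"
        by (simp only: diagonal_const_commute[symmetric] matrix_mul_assoc)
      then show ?thesis
        using that by (simp add: special_unitary_iff unitaryD(2))
    qed
    have "continuous_map (top_of_set ?I)
        (prod_topology (subtopology special_unitary_topology U) (top_of_set ?I)) (\<lambda>t. (?z, t))"
      using c US by (intro continuous_map_pairedI)
        (auto simp: special_unitary_topology_def subtopology_subtopology)
    from continuous_map_compose[OF this cont]
    have path: "continuous_map (top_of_set ?I) (top_of_set ?S) (\<lambda>t. H (?z, t))"
      by (simp add: comp_def special_unitary_topology_def)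
    then have HS: "H (?z, t) \<in> ?S" if "t \<in> ?I" for t
      using that by auto
    have scalar: "\<exists>k. k ^ CARD('n) = 1 \<and> H (?z, t) = diagonal (\<lambda>_. k)" if t: "t \<in> ?I" for t
    proof -
      have "g ** H (?z, t) ** conj_transpose g = H (?z, t)" if "g \<in> ?S" for g
        using equiv[OF that c(2) t] US c(2) conj_z[OF that]
        by (simp add: conjugation_action_special_unitary that HS[OF t] subset_iff)
      then show ?thesis
        using conjugation_fixed_point_imp_scalar[OF HS[OF t]] by metis
    qed
    \<comment> \<open>The diagonal entries along the path are roots of unity of a fixed order, and a
      continuous function on an interval with finitely many values is constant.\<close>
    have "(\<lambda>t. H (?z, t) $ i $ i) constant_on ?I" for i
    proof (rule continuous_finite_range_constant)
      show "continuous_on ?I (\<lambda>t. H (?z, t) $ i $ i)"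
        using path by (auto intro!: continuous_intros)
      have "(\<lambda>t. H (?z, t) $ i $ i) ` ?I \<subseteq> {k. k ^ CARD('n) = 1}"
        using scalar by fastforce
      moreover have "finite {k::complex. k ^ CARD('n) = 1}"
        by (rule finite_roots_unity) (simp add: Suc_leI)
      ultimately show "finite ((\<lambda>t. H (?z, t) $ i $ i) ` ?I)"
        by (rule finite_subset)
    qed simp
    then have "H (?z, 1) $ i $ i = H (?z, 0) $ i $ i" for i
      unfolding constant_on_def by (metis atLeastAtMost_iff order_refl zero_le_one)
    moreover obtain k where "H (?z, 1) = diagonal (\<lambda>_. k)"
      using scalar[of 1] by auto
    ultimately have "H (?z, 1) = ?z"
      by (simp add: H0[OF c(2)])
    \<comment> \<open>The scalar matrix is a conjugate of y; conjugating back leaves it unchanged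
      and returns y.\<close>
    then obtain g where g: "g \<in> ?S" "?z = g ** y ** conj_transpose g"
      using H1[OF c(2)] y by (auto simp: orbit_def conjugation_action_special_unitary)
    then have "conj_transpose g ** ?z ** g = (conj_transpose g ** g) ** y ** (conj_transpose g ** g)"
      by (simp only: matrix_mul_assoc)
    moreover have "conj_transpose g \<in> ?S"
      using g(1) by (simp add: special_unitary_iff unitary_conj_transpose det_conj_transpose)
    ultimately show ?thesis
      using conj_z[of "conj_transpose g"] g(1) by (simp add: special_unitary_iff unitaryD(1))
  qed
  from this[OF c] this[OF c'] have "diagonal (\<lambda>_. c) = (diagonal (\<lambda>_. c') :: complex^'n^'n)"
    by simp
  then show ?thesis
    by (metis diagonal_nth)
qed

section \<open>The equivariant category of SU(n+1)\<close>

theorem mainTheorem3: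
  fixes n :: nat
  assumes "n \<ge> 1" and "CARD('n::finite) = n + 1"
  shows "equivariant_cat
           (special_unitary_group :: (complex^'n^'n) monoid)
           (conjugation_action special_unitary_group)
           special_unitary_topology
         = enat (n + 1)"
proof (rule antisym)
  let ?G = "special_unitary_group :: (complex^'n^'n) monoid"
  let ?cat = "G_categorical ?G (conjugation_action ?G) special_unitary_topology"
  let ?covers = "{enat (card \<U>) | \<U>. finite \<U> \<and> (\<forall>U\<in>\<U>. ?cat U) \<and>
    topspace special_unitary_topology \<subseteq> \<Union>\<U>}"
  let ?\<U> = "alcove_star ` {0..<int CARD('n)} :: (complex^'n^'n) set set"
  have "topspace special_unitary_topology \<subseteq> \<Union>?\<U>"
  proof
    fix A :: "complex^'n^'n"
    assume "A \<in> topspace special_unitary_topology"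
    then have "A \<in> carrier ?G"
      by (simp add: special_unitary_topology_def)
    then obtain g \<theta> m where "g \<in> unitary" "\<theta> \<in> angles_lt m" "A = spectral (g, \<theta>)"
      "0 \<le> m" "m < int CARD('n)"
      by (rule special_unitary_eq_spectral)
    then show "A \<in> \<Union>?\<U>"
      by (intro UnionI[of "alcove_star m"]) (auto simp: alcove_star_def)
  qed
  then have "enat (card ?\<U>) \<in> ?covers"
    using G_categorical_alcove_star by blast
  then have "equivariant_cat ?G (conjugation_action ?G) special_unitary_topology \<le> enat (card ?\<U>)"
    unfolding equivariant_cat_def by (rule Inf_lower)
  \<comment> \<open>The cover is indexed by m = 0, ..., n, which bounds the number of its members by
    n + 1.\<close>
  also have "card ?\<U> \<le> card {0..<int CARD('n)}"
    by (rule card_image_le) simp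
  then have "enat (card ?\<U>) \<le> enat (n + 1)"
    using assms(2) by simp
  finally show "equivariant_cat ?G (conjugation_action ?G) special_unitary_topology \<le> enat (n + 1)" .
  show "enat (n + 1) \<le> equivariant_cat ?G (conjugation_action ?G) special_unitary_topology"
    unfolding equivariant_cat_def
  proof (rule Inf_greatest)
    fix e
    assume "e \<in> ?covers"
    then obtain \<U> where e: "e = enat (card \<U>)" and fin: "finite \<U>" and cat: "\<And>U. U \<in> \<U> \<Longrightarrow> ?cat U"
      and cover: "topspace special_unitary_topology \<subseteq> \<Union>\<U>"
      by blast
    let ?R = "{c::complex. c ^ CARD('n) = 1}"
    \<comment> \<open>Choosing a member of the cover around each central matrix gives an injection
      from the n + 1 roots of unity into the cover.\<close>
    have "\<forall>c\<in>?R. \<exists>U\<in>\<U>. diagonal (\<lambda>_. c) \<in> U"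
    proof
      fix c :: complex
      assume "c \<in> ?R"
      then have "(diagonal (\<lambda>_. c) :: complex^'n^'n) \<in> topspace special_unitary_topology"
        by (simp add: special_unitary_topology_def diagonal_const_special_unitary_iff)
      with cover show "\<exists>U\<in>\<U>. diagonal (\<lambda>_. c) \<in> U"
        by blast
    qed
    then obtain f where f: "\<And>c. c \<in> ?R \<Longrightarrow> f c \<in> \<U>" "\<And>c. c \<in> ?R \<Longrightarrow> diagonal (\<lambda>_. c) \<in> f c"
      by metis
    have "inj_on f ?R"
    proof (rule inj_onI)
      fix c c'
      assume *: "c \<in> ?R" "c' \<in> ?R" "f c = f c'"
      show "c = c'"
        using G_categorical_central_unique[OF cat[OF f(1)[OF *(1)]], of c c'] f(2)[of c] f(2)[of c'] *
        by simp
    qed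
    then have "card ?R \<le> card \<U>"
      using f(1) fin by (intro card_inj_on_le) auto
    moreover have "card ?R = n + 1"
      using assms(2) by (subst card_roots_unity_eq) simp_all
    ultimately show "enat (n + 1) \<le> e"
      by (simp add: e)
  qed
qed

end
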